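(* There is no $2$-connected nontrivial uniquely $C_9$-saturated graph $G$ whose longest even cycle of length at most $12$ has length $4$; that is, no $2$-connected nontrivial uniquely $C_9$-saturated graph contains a cycle of length $4$ and no cycle of length $6$, $8$, $10$ or $12$.
   Context: All graphs are finite and simple. A graph $G$ is uniquely $C_9$-saturated if it contains no cycle of length $9$ and, for every edge $e$ of the complement $\overline{G}$, $G+e$ contains exactly one cycle of length $9$; it is nontrivial if $|V(G)|\ge 9$. "Longest even cycle of length at most $12$" means a longest cycle among all even cycles of $G$ whose length is at most $12$. *)

theory Defs
  imports Main
begin

text \<open>
  A graph is given by its vertex set \<open>V\<close> and its edge set \<open>E\<close>, the edges being
  two-element sets of vertices.
\<close>

definition all_pairs :: "'a set \<Rightarrow> 'a set set" where
  "all_pairs V = {e. e \<subseteq> V \<and> card e = 2}"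

definition simple_graph :: "'a set \<Rightarrow> 'a set set \<Rightarrow> bool" where
  "simple_graph V E \<longleftrightarrow> finite V \<and> E \<subseteq> all_pairs V"

definition complement_edges :: "'a set \<Rightarrow> 'a set set \<Rightarrow> 'a set set" where
  "complement_edges V E = all_pairs V - E"

definition closed_walk_edges :: "'a list \<Rightarrow> 'a set set" where
  "closed_walk_edges vs = {{vs ! i, vs ! (Suc i mod length vs)} | i. i < length vs}"

text \<open>
  Cycles are subgraphs, so the rotations and the reversal of a vertex sequence give the
  same cycle. Having no isolated vertices, a cycle is determined by its edge set, and it is
  represented by that set: cycles are counted by counting edge sets \<open>C\<close>.
\<close>

definition is_cycle :: "'a set set \<Rightarrow> nat \<Rightarrow> 'a set set \<Rightarrow> bool" where
  "is_cycle E n C \<longleftrightarrow> 3 \<le> n \<and> C \<subseteq> E \<and>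
     (\<exists>vs. length vs = n \<and> distinct vs \<and> C = closed_walk_edges vs)"

definition has_cycle :: "'a set set \<Rightarrow> nat \<Rightarrow> bool" where
  "has_cycle E n \<longleftrightarrow> (\<exists>C. is_cycle E n C)"

definition uniquely_cycle_saturated :: "nat \<Rightarrow> 'a set \<Rightarrow> 'a set set \<Rightarrow> bool" where
  "uniquely_cycle_saturated k V E \<longleftrightarrow>
     \<not> has_cycle E k \<and> (\<forall>e \<in> complement_edges V E. \<exists>!C. is_cycle (insert e E) k C)"

definition nontrivial :: "nat \<Rightarrow> 'a set \<Rightarrow> bool" where
  "nontrivial k V \<longleftrightarrow> k \<le> card V"

definition connected_graph :: "'a set \<Rightarrow> 'a set set \<Rightarrow> bool" where
  "connected_graph V E \<longleftrightarrow> V \<noteq> {} \<and> (\<forall>u \<in> V. \<forall>v \<in> V. (u, v) \<in> {(x, y). {x, y} \<in> E}\<^sup>*)"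

definition k_connected :: "nat \<Rightarrow> 'a set \<Rightarrow> 'a set set \<Rightarrow> bool" where
  "k_connected k V E \<longleftrightarrow> k < card V \<and>
     (\<forall>S. S \<subseteq> V \<and> card S < k \<longrightarrow> connected_graph (V - S) {e \<in> E. e \<inter> S = {}})"

text \<open>The longest cycles among the even cycles of length at most \<open>m\<close> exist and have length \<open>l\<close>.\<close>

definition longest_even_cycle_length :: "'a set set \<Rightarrow> nat \<Rightarrow> nat \<Rightarrow> bool" where
  "longest_even_cycle_length E m l \<longleftrightarrow> even l \<and> l \<le> m \<and> has_cycle E l \<and>
     (\<forall>n. even n \<and> n \<le> m \<and> has_cycle E n \<longrightarrow> n \<le> l)"

lemma longest_even_cycle_length_12_4:
  "longest_even_cycle_length E 12 4 \<longleftrightarrow> has_cycle E 4 \<and>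
     \<not> has_cycle E 6 \<and> \<not> has_cycle E 8 \<and> \<not> has_cycle E 10 \<and> \<not> has_cycle E 12"
proof
  assume "longest_even_cycle_length E 12 4"
  then have "\<not> has_cycle E n" if "even n" "n \<le> 12" "4 < n" for n
    using that unfolding longest_even_cycle_length_def by (meson not_le)
  moreover have "has_cycle E 4"
    using \<open>longest_even_cycle_length E 12 4\<close> unfolding longest_even_cycle_length_def by blast
  ultimately show "has_cycle E 4 \<and>
     \<not> has_cycle E 6 \<and> \<not> has_cycle E 8 \<and> \<not> has_cycle E 10 \<and> \<not> has_cycle E 12"
    by simp
next
  assume *: "has_cycle E 4 \<and>
     \<not> has_cycle E 6 \<and> \<not> has_cycle E 8 \<and> \<not> has_cycle E 10 \<and> \<not> has_cycle E 12"
  have "n \<le> 4" if "even n" "n \<le> 12" "has_cycle E n" for n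
  proof -
    have "n \<le> 4 \<or> n = 6 \<or> n = 8 \<or> n = 10 \<or> n = 12"
      using that(1,2) by presburger
    with * that(3) show ?thesis by blast
  qed
  with * show "longest_even_cycle_length E 12 4"
    unfolding longest_even_cycle_length_def by simp
qed

end

theory Submission
  imports Defs
begin

text \<open>
  Write "path" for a list of distinct vertices whose consecutive entries are adjacent. Two
  non-adjacent vertices of a uniquely \<open>C\<^sub>9\<close>-saturated graph are the ends of exactly one path
  with 9 vertices. Suppose the graph has a cycle of length 4, but none of length 6, 8 or 10.

  The diagonals of every 4-cycle \<open>a b c d\<close> are edges (\<open>four_cycle_diagonal\<close>). Otherwise take the
  path with 9 vertices from \<open>a\<close> to \<open>c\<close>. It contains \<open>b\<close> and \<open>d\<close>, since it would close to a
  10-cycle through a vertex it avoids. The three segments into which \<open>b\<close> and \<open>d\<close> cut it combine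
  with the edges of the 4-cycle to several cycles, and whatever the lengths of the segments,
  one of these cycles has length 6, 8 or 9.

  So there is a maximal clique \<open>K\<close> with at least 4 vertices. A path that leaves \<open>K\<close> and comes back
  closes to cycles of three consecutive lengths, since in \<open>K\<close> one can go back directly
  or through one or two further vertices. If the detour has 2 to 8 outside vertices, one of the
  three lengths is 6, 8 or 10; a detour through a single outside vertex is excluded by
  the diagonal property and maximality. So no path with at most 10 vertices leaves \<open>K\<close> and comes
  back (\<open>path_stays_in_clique\<close>).

  The graph is connected and is not complete, so there are adjacent vertices \<open>x \<in> K\<close> and
  \<open>v \<notin> K\<close>, and some \<open>z \<in> K\<close> is not adjacent to \<open>v\<close>. The path with 9 vertices from \<open>v\<close> to \<open>z\<close>
  enters \<open>K\<close> at \<open>x\<close> and stays in \<open>K\<close> from there on. If it goes from \<open>x\<close> directly to \<open>z\<close>, then its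
  part from \<open>v\<close> to \<open>x\<close> closes to an 8-cycle. Otherwise the part inside \<open>K\<close> can be varied,
  contradicting uniqueness.
\<close>

section \<open>Edge sets of vertex sequences\<close>

fun path_edges :: "'a list \<Rightarrow> 'a set set" where
  "path_edges [] = {}"
| "path_edges [x] = {}"
| "path_edges (x # y # ys) = insert {x, y} (path_edges (y # ys))"

lemma path_edges_Cons:
  "path_edges (x # ys) = (if ys = [] then {} else insert {x, hd ys} (path_edges ys))"
  by (cases ys) auto

lemma path_edges_append:
  "path_edges (xs @ ys) = path_edges xs \<union> path_edges ys \<union>
     (if xs = [] \<or> ys = [] then {} else {{last xs, hd ys}})"
  by (induction xs rule: path_edges.induct) (auto simp: path_edges_Cons)

lemma path_edges_rev: "path_edges (rev xs) = path_edges xs"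
proof (induction xs rule: path_edges.induct)
  case (3 x y ys)
  then show ?case
    using path_edges_append[of "rev ys @ [y]" "[x]"] by (simp add: insert_commute[of y x "{}"])
qed simp_all

lemma path_edges_subset_vertices: "e \<in> path_edges xs \<Longrightarrow> e \<subseteq> set xs"
  by (induction xs rule: path_edges.induct) auto

lemma path_edges_in_clique:
  assumes "distinct xs" "set xs \<subseteq> K" "all_pairs K \<subseteq> E"
  shows "path_edges xs \<subseteq> E"
  using assms
  by (induction xs rule: path_edges.induct) (auto simp: all_pairs_def subset_iff)

lemma path_edges_conv_nth: "path_edges xs = {{xs ! i, xs ! Suc i} | i. Suc i < length xs}"
proof (induction xs rule: path_edges.induct)
  case (3 x y ys)
  have "{{(x # y # ys) ! i, (x # y # ys) ! Suc i} | i. Suc i < length (x # y # ys)} =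
    insert {x, y} {{(y # ys) ! i, (y # ys) ! Suc i} | i. Suc i < length (y # ys)}" (is "?L = ?R")
  proof
    show "?L \<subseteq> ?R"
    proof
      fix e assume "e \<in> ?L"
      then obtain i where i: "e = {(x # y # ys) ! i, (x # y # ys) ! Suc i}"
        "Suc i < length (x # y # ys)" by blast
      show "e \<in> ?R" using i by (cases i) auto
    qed
    show "?R \<subseteq> ?L"
    proof
      fix e assume "e \<in> ?R"
      then consider "e = {x, y}" | i where "e = {(y # ys) ! i, (y # ys) ! Suc i}"
        "Suc i < length (y # ys)" by blast
      then show "e \<in> ?L"
      proof cases
        case 1
        then have "e = {(x # y # ys) ! 0, (x # y # ys) ! Suc 0} \<and> Suc 0 < length (x # y # ys)"
          by simp
        then show ?thesis by blast
      next
        case 2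
        then have "e = {(x # y # ys) ! Suc i, (x # y # ys) ! Suc (Suc i)} \<and>
          Suc (Suc i) < length (x # y # ys)" by simp
        then show ?thesis by blast
      qed
    qed
  qed
  with 3 show ?case by simp
qed auto

lemma closed_walk_edges_conv_path_edges:
  assumes "xs \<noteq> []"
  shows "closed_walk_edges xs = insert {last xs, hd xs} (path_edges xs)"
proof -
  have "i < length xs \<longleftrightarrow> Suc i < length xs \<or> i = length xs - 1" for i
    using assms by (cases xs) auto
  then have "closed_walk_edges xs = {{xs ! i, xs ! (Suc i mod length xs)} | i. Suc i < length xs}
     \<union> {{xs ! (length xs - 1), xs ! (Suc (length xs - 1) mod length xs)}}"
    unfolding closed_walk_edges_def by blast
  moreover have "{{xs ! i, xs ! (Suc i mod length xs)} | i. Suc i < length xs} = path_edges xs"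
    unfolding path_edges_conv_nth by (metis (lifting) mod_less)
  ultimately show ?thesis
    using assms by (simp add: last_conv_nth hd_conv_nth)
qed

lemma closed_walk_edges_rotate: "closed_walk_edges (rotate n xs) = closed_walk_edges xs"
proof (induction n)
  case (Suc n)
  have "closed_walk_edges (rotate1 ys) = closed_walk_edges ys" for ys :: "'a list"
    by (cases ys) (auto simp: closed_walk_edges_conv_path_edges path_edges_append path_edges_Cons
        insert_commute)
  with Suc show ?case by simp
qed simp

lemma closed_walk_cut_at_edge:
  assumes "{u, v} \<in> closed_walk_edges xs" "distinct xs"
  shows "\<exists>ys. length ys = length xs \<and> distinct ys \<and> hd ys = u \<and> last ys = v \<and>
    closed_walk_edges ys = closed_walk_edges xs"
proof -
  obtain i where i: "i < length xs" "{u, v} = {xs ! i, xs ! (Suc i mod length xs)}"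
    using assms(1) unfolding closed_walk_edges_def by blast
  define ys where "ys = rotate (Suc i) xs"
  have ne: "xs \<noteq> []" "ys \<noteq> []" using i unfolding ys_def by auto
  have "hd ys = xs ! (Suc i mod length xs)"
    using ne unfolding ys_def by (simp add: hd_rotate_conv_nth del: rotate_Suc)
  moreover have "last ys = xs ! i"
  proof -
    have "last ys = xs ! ((Suc i + (length xs - 1)) mod length xs)"
      using ne unfolding ys_def by (simp add: last_conv_nth nth_rotate del: rotate_Suc)
    moreover have "Suc i + (length xs - 1) = i + length xs" using i by simp
    ultimately show ?thesis using i by simp
  qed
  ultimately have uv: "{u, v} = {last ys, hd ys}" using i by simp
  have ys: "length ys = length xs" "distinct ys" "closed_walk_edges ys = closed_walk_edges xs"
    using assms(2) unfolding ys_def by (simp_all add: closed_walk_edges_rotate del: rotate_Suc)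
  show ?thesis
  proof (cases "hd ys = u")
    case True
    then show ?thesis using uv ys by (auto simp: doubleton_eq_iff)
  next
    case False
    then have "hd ys = v" "last ys = u" using uv by (auto simp: doubleton_eq_iff)
    moreover have "closed_walk_edges (rev ys) = closed_walk_edges ys"
      using ne by (simp add: closed_walk_edges_conv_path_edges path_edges_rev hd_rev last_rev
          insert_commute)
    ultimately show ?thesis using ys ne
      by (intro exI[of _ "rev ys"]) (simp add: hd_rev last_rev)
  qed
qed

lemma has_cycleI:
  assumes "distinct xs" "3 \<le> length xs" "path_edges xs \<subseteq> E" "{last xs, hd xs} \<in> E"
  shows "has_cycle E (length xs)"
proof -
  have "xs \<noteq> []" using assms(2) by auto
  then have "closed_walk_edges xs \<subseteq> E"
    using assms by (simp add: closed_walk_edges_conv_path_edges)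
  then show ?thesis
    using assms unfolding has_cycle_def is_cycle_def by blast
qed

lemma has_cycle_clique:
  assumes "all_pairs K \<subseteq> E" "finite K" "3 \<le> n" "n \<le> card K"
  shows "has_cycle E n"
proof -
  obtain T where T: "T \<subseteq> K" "card T = n" using assms by (meson obtain_subset_with_card_n)
  then obtain xs where xs: "set xs = T" "distinct xs"
    using assms finite_distinct_list finite_subset by metis
  then have len: "length xs = n" using T distinct_card by fastforce
  obtain y ys where y: "xs = y # ys" "ys \<noteq> []"
    using len assms(3) by (cases xs; cases "tl xs") auto
  have "{last xs, hd xs} \<in> all_pairs K"
    using y xs T last_in_set[of ys] by (auto simp: all_pairs_def card_insert_if)
  then show ?thesis
    using has_cycleI[of xs E] path_edges_in_clique[of xs K E] xs T len assms by auto
qed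

section \<open>Cliques and paths in saturated graphs without short even cycles\<close>

locale uniquely_C9_saturated_sparse =
  fixes V :: "'a set" and E :: "'a set set"
  assumes simple: "simple_graph V E"
    and saturated: "uniquely_cycle_saturated 9 V E"
    and no_even_cycle: "\<not> has_cycle E 6" "\<not> has_cycle E 8" "\<not> has_cycle E 10"
begin

lemma no_C9: "\<not> has_cycle E 9"
  using saturated unfolding uniquely_cycle_saturated_def by blast

lemma edge_in_V: "{u, v} \<in> E \<Longrightarrow> u \<in> V \<and> v \<in> V \<and> u \<noteq> v"
  using simple unfolding simple_graph_def all_pairs_def by (auto simp: card_insert_if split: if_splits)

lemma no_cycle_list:
  assumes "distinct xs" "path_edges xs \<subseteq> E" "{last xs, hd xs} \<in> E"
  shows "length xs \<notin> {6, 8, 9, 10}"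
proof
  assume "length xs \<in> {6, 8, 9, 10}"
  then show False
    using has_cycleI[OF assms(1) _ assms(2,3)] no_even_cycle no_C9 by auto
qed

definition nine_path :: "'a \<Rightarrow> 'a \<Rightarrow> 'a list \<Rightarrow> bool" where
  "nine_path u v p \<longleftrightarrow>
     length p = 9 \<and> distinct p \<and> hd p = u \<and> last p = v \<and> path_edges p \<subseteq> E"

lemma nine_path_exists:
  assumes "u \<in> V" "v \<in> V" "u \<noteq> v" "{u, v} \<notin> E"
  obtains p where "nine_path u v p"
proof -
  have "{u, v} \<in> complement_edges V E"
    using assms unfolding complement_edges_def all_pairs_def by auto
  then obtain C where C: "is_cycle (insert {u, v} E) 9 C"
    using saturated unfolding uniquely_cycle_saturated_def by blast
  then have "\<not> C \<subseteq> E"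
    using no_C9 unfolding has_cycle_def is_cycle_def by blast
  with C have "{u, v} \<in> C" unfolding is_cycle_def by blast
  with C obtain p where p: "length p = 9" "distinct p" "hd p = u" "last p = v"
    "closed_walk_edges p = C"
    unfolding is_cycle_def using closed_walk_cut_at_edge[of u v] by metis
  have "p \<noteq> []" using p by auto
  then have "path_edges p \<subseteq> insert {u, v} E"
    using C p unfolding is_cycle_def by (auto simp: closed_walk_edges_conv_path_edges)
  moreover have "{u, v} \<notin> path_edges p"
  proof -
    obtain q where q: "p = u # q" using p \<open>p \<noteq> []\<close> by (cases p) auto
    then have "2 \<le> length q" using p by simp
    then obtain y r where y: "q = y # r" "r \<noteq> []" by (cases q; cases "tl q") auto
    \<comment> \<open>The first edge of the path ends before \<open>v\<close>, and the others avoid \<open>u\<close>.\<close>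
    have "v \<in> set r" using p q y by auto
    then have "v \<noteq> y" using p q y by auto
    moreover have "{u, v} \<notin> path_edges q"
      using path_edges_subset_vertices[of "{u, v}" q] p q by auto
    ultimately show ?thesis using q y assms by (auto simp: doubleton_eq_iff)
  qed
  ultimately have "nine_path u v p" using p unfolding nine_path_def by blast
  then show thesis by (rule that)
qed

lemma nine_path_unique:
  assumes "nine_path u v p" "nine_path u v q"
    "u \<in> V" "v \<in> V" "u \<noteq> v" "{u, v} \<notin> E"
  shows "insert {u, v} (path_edges p) = insert {u, v} (path_edges q)"
proof -
  have cyc: "is_cycle (insert {u, v} E) 9 (insert {u, v} (path_edges r))" if "nine_path u v r" for r
  proof -
    have "r \<noteq> []" using that unfolding nine_path_def by auto
    then have "closed_walk_edges r = insert {u, v} (path_edges r)"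
      using that unfolding nine_path_def
      by (simp add: closed_walk_edges_conv_path_edges insert_commute)
    then show ?thesis using that unfolding nine_path_def is_cycle_def by auto
  qed
  have "{u, v} \<in> complement_edges V E"
    using assms unfolding complement_edges_def all_pairs_def by auto
  then show ?thesis
    using saturated cyc[OF assms(1)] cyc[OF assms(2)]
    unfolding uniquely_cycle_saturated_def by blast
qed

text \<open>
  Let \<open>i\<close>, \<open>j\<close>, \<open>k\<close> be the numbers of inner vertices of the segments of the path from \<open>a\<close> to \<open>b\<close>,
  from \<open>b\<close> to \<open>d\<close> and from \<open>d\<close> to \<open>c\<close>, so \<open>i + j + k = 5\<close>. The first and third segments together with
  the edges \<open>bc\<close> and \<open>da\<close> form a cycle of length \<open>i + k + 4 = 9 - j\<close>, which excludes \<open>j = 0, 1, 3\<close>; the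
  middle segment with \<open>a\<close> excludes \<open>j = 5\<close>. The first two segments with \<open>da\<close>, or the last two
  with \<open>bc\<close>, exclude 0 and 2 as values of \<open>k\<close> and \<open>i\<close>. The cases \<open>j = 2\<close> and \<open>j = 4\<close>
  then leave no value of \<open>(i, k)\<close>.
\<close>

lemma no_nine_path_through_four_cycle:
  assumes edges: "{a, b} \<in> E" "{b, c} \<in> E" "{c, d} \<in> E" "{d, a} \<in> E"
    and p: "nine_path a c (a # A @ b # B @ d # D @ [c])"
  shows False
proof -
  let ?p = "a # A @ b # B @ d # D @ [c]"
  have dist: "distinct ?p" and sub: "path_edges ?p \<subseteq> E" and len: "length A + length B + length D = 5"
    using p unfolding nine_path_def by auto
  note split = path_edges_append path_edges_Cons path_edges_rev hd_append hd_rev last_rev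
  have "path_edges (b # B @ [d, a]) \<subseteq> E" "path_edges (a # A @ b # B @ [d]) \<subseteq> E"
    "path_edges (b # B @ d # D @ [c]) \<subseteq> E" "path_edges (a # A @ b # c # rev D @ [d]) \<subseteq> E"
    using sub edges by (auto simp: split insert_commute split: if_splits)
  then have "length (b # B @ [d, a]) \<notin> {6, 8, 9, 10}"
    "length (a # A @ b # B @ [d]) \<notin> {6, 8, 9, 10}"
    "length (b # B @ d # D @ [c]) \<notin> {6, 8, 9, 10}"
    "length (a # A @ b # c # rev D @ [d]) \<notin> {6, 8, 9, 10}"
    using dist edges by (intro no_cycle_list; auto simp: insert_commute)+
  then have "length B \<notin> {3, 5}" "length A + length B \<notin> {3, 5}" "length B + length D \<notin> {3, 5}"
    "length A + length D \<notin> {2, 4, 5}"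
    by auto
  then show False using len by simp
qed

lemma four_cycle_diagonal:
  assumes edges: "{a, b} \<in> E" "{b, c} \<in> E" "{c, d} \<in> E" "{d, a} \<in> E"
    and "a \<noteq> c" "b \<noteq> d"
  shows "{a, c} \<in> E"
proof (rule ccontr)
  assume "{a, c} \<notin> E"
  then obtain p where p: "nine_path a c p"
    using nine_path_exists[of a c] edge_in_V edges \<open>a \<noteq> c\<close> by blast
  then have p': "length p = 9" "distinct p" "hd p = a" "last p = c" "path_edges p \<subseteq> E"
    unfolding nine_path_def by auto
  have common_nb: "w \<in> set p" if "{a, w} \<in> E" "{w, c} \<in> E" for w
  proof (rule ccontr)
    assume "w \<notin> set p"
    moreover have "p \<noteq> []" using p' by auto
    ultimately show False
      using no_cycle_list[of "w # p"] p' that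
      by (auto simp: path_edges_Cons insert_commute)
  qed
  obtain r where r: "p = a # r @ [c]"
  proof -
    obtain q where "p = a # q" using p' by (cases p) auto
    moreover have "q \<noteq> []" using calculation p' by auto
    ultimately have "p = a # butlast q @ [c]" using p' by (metis append_butlast_last_id last_ConsR)
    then show thesis by (rule that)
  qed
  have "b \<in> set r" "d \<in> set r"
    using common_nb[of b] common_nb[of d] edges edge_in_V r by (auto simp: insert_commute)
  then obtain A R where A: "r = A @ b # R" by (meson split_list)
  consider "d \<in> set R" | "d \<in> set A" using \<open>d \<in> set r\<close> A \<open>b \<noteq> d\<close> by auto
  then show False
  proof cases
    case 1
    then obtain B D where "R = B @ d # D" by (meson split_list)
    then show False
      using no_nine_path_through_four_cycle[OF edges, of A B D] p r A by simp
  next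
    case 2
    then obtain B D where "A = B @ d # D" by (meson split_list)
    then show False
      using no_nine_path_through_four_cycle[of a d c b B D R] p r A edges
      by (simp add: insert_commute)
  qed
qed

definition maximal_clique :: "'a set \<Rightarrow> bool" where
  "maximal_clique K \<longleftrightarrow> K \<subseteq> V \<and> all_pairs K \<subseteq> E \<and> (\<forall>v \<in> V - K. \<exists>z \<in> K. {v, z} \<notin> E)"

lemma clique_edge: "maximal_clique K \<Longrightarrow> x \<in> K \<Longrightarrow> y \<in> K \<Longrightarrow> x \<noteq> y \<Longrightarrow> {x, y} \<in> E"
  unfolding maximal_clique_def all_pairs_def by auto

lemma maximal_clique_exists:
  assumes "has_cycle E 4"
  obtains K where "maximal_clique K" "4 \<le> card K"
proof -
  obtain vs where vs: "length vs = 4" "distinct vs" "closed_walk_edges vs \<subseteq> E"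
    using assms unfolding has_cycle_def is_cycle_def by auto
  then obtain a b c d where abcd: "vs = [a, b, c, d]"
    by (auto simp: numeral_eq_Suc length_Suc_conv)
  have edges: "{a, b} \<in> E" "{b, c} \<in> E" "{c, d} \<in> E" "{d, a} \<in> E"
    using vs abcd by (auto simp: closed_walk_edges_conv_path_edges)
  have dist: "distinct [a, b, c, d]" using vs abcd by simp
  have "{a, c} \<in> E" "{b, d} \<in> E"
    using four_cycle_diagonal[of a b c d] four_cycle_diagonal[of b c d a] edges dist by auto
  then have "all_pairs {a, b, c, d} \<subseteq> E"
    using edges by (auto simp: all_pairs_def card_2_iff insert_commute)
  moreover have "{a, b, c, d} \<subseteq> V" using edges edge_in_V by blast
  moreover have "card {a, b, c, d} = 4" using dist by simp
  moreover have "finite V" using simple unfolding simple_graph_def by blast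
  ultimately obtain K where K: "K \<subseteq> V" "all_pairs K \<subseteq> E" "{a, b, c, d} \<subseteq> K"
    and max: "\<forall>L \<in> {L. L \<subseteq> V \<and> all_pairs L \<subseteq> E}. K \<subseteq> L \<longrightarrow> K = L"
    using finite_has_maximal2[of "{L. L \<subseteq> V \<and> all_pairs L \<subseteq> E}" "{a, b, c, d}"] by auto
  have "\<exists>z \<in> K. {v, z} \<notin> E" if "v \<in> V - K" for v
  proof (rule ccontr)
    assume "\<not> (\<exists>z \<in> K. {v, z} \<notin> E)"
    then have adj: "{v, z} \<in> E" if "z \<in> K" for z using that by blast
    have "all_pairs (insert v K) \<subseteq> E"
    proof
      fix e assume "e \<in> all_pairs (insert v K)"
      then obtain y z where e: "e = {y, z}" "y \<noteq> z" "y \<in> insert v K" "z \<in> insert v K"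
        unfolding all_pairs_def card_2_iff by auto
      show "e \<in> E"
      proof (cases "y = v \<or> z = v")
        case True
        then show ?thesis using e adj by (auto simp: insert_commute[of y v "{}"])
      next
        case False
        then have "e \<in> all_pairs K" using e unfolding all_pairs_def by auto
        then show ?thesis using K by blast
      qed
    qed
    then show False using max that K by blast
  qed
  then have "maximal_clique K" using K unfolding maximal_clique_def by blast
  moreover have "4 \<le> card K"
    using card_mono[of K "{a, b, c, d}"] K \<open>card {a, b, c, d} = 4\<close> \<open>finite V\<close> finite_subset by auto
  ultimately show thesis by (rule that)
qed

lemma exists_further_clique_vertex:
  assumes "card T < card K" "finite T"
  shows "\<exists>w \<in> K. w \<notin> T"
  using assms by (metis card_mono leD subsetI)

text \<open>
  Two further vertices of \<open>K\<close> turn the detour into cycles with 2, 3 or 4 more vertices than \<open>q\<close>, one of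
  which has length 6, 8 or 10 unless \<open>q\<close> is a single vertex. That vertex would lie on a 4-cycle
  opposite to each vertex of \<open>K\<close> other than \<open>x\<close> and \<open>w\<close>, and the diagonals of these cycles would make
  it adjacent to all of \<open>K\<close>.
\<close>

lemma no_detour:
  assumes K: "maximal_clique K" "4 \<le> card K" and "x \<in> K" "w \<in> K"
    and q: "q \<noteq> []" "length q \<le> 8" "set q \<inter> K = {}"
    and path: "distinct (x # q @ [w])" "path_edges (x # q @ [w]) \<subseteq> E"
  shows False
proof -
  have "x \<noteq> w" using path by auto
  obtain u where u: "u \<in> K" "u \<noteq> x" "u \<noteq> w"
    using exists_further_clique_vertex[of "{x, w}" K] K \<open>x \<noteq> w\<close> by auto
  obtain u' where u': "u' \<in> K" "u' \<noteq> x" "u' \<noteq> w" "u' \<noteq> u"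
    using exists_further_clique_vertex[of "{x, w, u}" K] K u \<open>x \<noteq> w\<close> by auto
  have new: "u \<notin> set q" "u' \<notin> set q" using u u' q by auto
  note edge = clique_edge[OF K(1)]
  show False
  proof (cases "length q = 1")
    case True
    then obtain v where v: "q = [v]" by (cases q) auto
    have vxw: "{v, x} \<in> E" "{w, v} \<in> E" using path v by (auto simp: insert_commute)
    have "v \<in> V - K" using vxw edge_in_V q v by auto
    then obtain z where z: "z \<in> K" "{v, z} \<notin> E" using K unfolding maximal_clique_def by blast
    have "z \<noteq> x" "z \<noteq> w" using vxw z by (auto simp: insert_commute)
    then have "{v, z} \<in> E"
      using four_cycle_diagonal[of v x z w] vxw edge z \<open>x \<in> K\<close> \<open>w \<in> K\<close> \<open>x \<noteq> w\<close> \<open>v \<in> V - K\<close> by auto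
    with z show False by blast
  next
    case False
    have "path_edges (x # q @ [w, u]) \<subseteq> E" "path_edges (x # q @ [w, u, u']) \<subseteq> E"
      using path edge u u' \<open>w \<in> K\<close> by (auto simp: path_edges_append path_edges_Cons)
    then have "length (x # q @ [w]) \<notin> {6, 8, 9, 10}" "length (x # q @ [w, u]) \<notin> {6, 8, 9, 10}"
      "length (x # q @ [w, u, u']) \<notin> {6, 8, 9, 10}"
      using path edge u u' new \<open>x \<noteq> w\<close> \<open>x \<in> K\<close> \<open>w \<in> K\<close> by (intro no_cycle_list; auto)+
    moreover have "2 \<le> length q" using False q by (cases q; cases "tl q") auto
    ultimately show False using q(2) by simp
  qed
qed

lemma path_stays_in_clique:
  assumes K: "maximal_clique K" "4 \<le> card K"
    and "p \<noteq> []" "hd p \<in> K" "last p \<in> K" "distinct p" "path_edges p \<subseteq> E" "length p \<le> 10"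
  shows "set p \<subseteq> K"
  using assms(3-)
proof (induction p)
  case (Cons x r)
  show ?case
  proof (cases "r = [] \<or> hd r \<in> K")
    case True
    then show ?thesis using Cons by (cases "r = []") (auto simp: path_edges_Cons)
  next
    case False
    define q where "q = takeWhile (\<lambda>v. v \<notin> K) r"
    have "last r \<in> set r" "last r \<in> K" using False Cons.prems by auto
    then have "dropWhile (\<lambda>v. v \<notin> K) r \<noteq> []" by (auto simp: dropWhile_eq_Nil_conv)
    then obtain w s where w: "dropWhile (\<lambda>v. v \<notin> K) r = w # s" by (meson neq_Nil_conv)
    have r: "r = q @ w # s" using w unfolding q_def by (metis takeWhile_dropWhile_id)
    have "w \<in> K" using w by (metis hd_dropWhile list.sel(1) list.distinct(1))
    have "set q \<inter> K = {}" unfolding q_def by (auto dest: set_takeWhileD)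
    moreover have "q \<noteq> []" using False \<open>w \<in> K\<close> r by auto
    moreover have "path_edges (x # q @ [w]) \<subseteq> E"
      using Cons.prems r by (auto simp: path_edges_append path_edges_Cons hd_append split: if_splits)
    moreover have "distinct (x # q @ [w])" "length q \<le> 8" using Cons.prems r by auto
    ultimately have False using no_detour[OF K _ \<open>w \<in> K\<close>] Cons.prems by auto
    then show ?thesis ..
  qed
qed simp

text \<open>
  If the path had vertices between \<open>x\<close> and \<open>z\<close>, it could be changed there, contradicting
  uniqueness: swap the first two of these vertices, or exchange a single one for a fourth vertex
  of \<open>K\<close>. The edge \<open>xy\<close> to the first vertex \<open>y\<close> after \<open>x\<close> is then lost, so the new path is a different one.
\<close>

lemma nine_path_leaves_clique_at_end:
  assumes K: "maximal_clique K" "4 \<le> card K" and "x \<in> K" "set s \<subseteq> K" "set p \<inter> K = {}" "p \<noteq> []"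
    and nine: "nine_path v z (p @ x # s)"
    and "v \<in> V" "z \<in> V" "v \<noteq> z" "{v, z} \<notin> E"
  shows "length s \<le> 1"
proof (rule ccontr)
  assume "\<not> length s \<le> 1"
  then obtain y t where s: "s = y # t" "t \<noteq> []" by (cases s; cases "tl s") auto
  have path: "length p + length t = 7" "distinct (p @ x # y # t)" "hd p = v" "last t = z"
    "path_edges (p @ x # y # t) \<subseteq> E"
    using nine s \<open>p \<noteq> []\<close> unfolding nine_path_def by auto
  have z: "z \<in> set t" using path s by auto
  have xy: "x \<noteq> v" "y \<noteq> v" "x \<noteq> z" "y \<noteq> z" "x \<noteq> y" using path z hd_in_set[OF \<open>p \<noteq> []\<close>] by auto
  have reroute: False if s': "set s' \<subseteq> K" "length s' = length s" "last s' = z" "distinct (x # s')"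
    "{x, y} \<notin> path_edges (x # s')" for s'
  proof -
    have "s' \<noteq> []" using s' s by auto
    have "path_edges (x # s') \<subseteq> E"
      using path_edges_in_clique[of "x # s'" K E] s' K \<open>x \<in> K\<close> unfolding maximal_clique_def by auto
    then have "nine_path v z (p @ x # s')"
      using s' path s \<open>p \<noteq> []\<close> \<open>s' \<noteq> []\<close> \<open>x \<in> K\<close> \<open>set p \<inter> K = {}\<close> unfolding nine_path_def
      by (auto simp: path_edges_append)
    then have "insert {v, z} (path_edges (p @ x # s)) = insert {v, z} (path_edges (p @ x # s'))"
      using nine_path_unique nine assms by blast
    moreover have "{x, y} \<in> path_edges (p @ x # s)" using s by (simp add: path_edges_append)
    ultimately have "{x, y} \<in> insert {v, z} (path_edges (p @ x # s'))" by (metis insertI2)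
    moreover have "path_edges (p @ x # s') = path_edges p \<union> path_edges (x # s') \<union> {{last p, x}}"
      using \<open>p \<noteq> []\<close> by (simp add: path_edges_append)
    moreover have "{x, y} \<noteq> {v, z}" using xy by (auto simp: doubleton_eq_iff)
    moreover have "{x, y} \<notin> path_edges p"
      using path_edges_subset_vertices[of "{x, y}" p] path by auto
    moreover have "{x, y} \<noteq> {last p, x}"
      using path last_in_set[OF \<open>p \<noteq> []\<close>] by (auto simp: doubleton_eq_iff)
    ultimately show False using s'(5) by (simp only: Un_iff insert_iff empty_iff simp_thms)
  qed
  show False
  proof (cases "length t = 1")
    case True
    then have t: "t = [z]" using path by (cases t) auto
    obtain y' where y': "y' \<in> K" "y' \<notin> {x, y, z}"
      using exists_further_clique_vertex[of "{x, y, z}" K] K xy by auto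
    show False
      using reroute[of "[y', z]"] y' s t xy \<open>set s \<subseteq> K\<close> by (auto simp: doubleton_eq_iff)
  next
    case False
    then obtain y' t' where t: "t = y' # t'" "t' \<noteq> []" using s by (cases t) auto
    have "{x, y} \<notin> path_edges (y' # y # t')"
      using path_edges_subset_vertices[of "{x, y}" "y' # y # t'"] path t by auto
    then show False
      using reroute[of "y' # y # t'"] s t path xy \<open>set s \<subseteq> K\<close> by (auto simp: doubleton_eq_iff)
  qed
qed

lemma maximal_clique_no_outgoing_edge:
  assumes K: "maximal_clique K" "4 \<le> card K" and "x \<in> K" "v \<in> V - K" "{x, v} \<in> E"
  shows False
proof -
  obtain z where z: "z \<in> K" "{v, z} \<notin> E" using K assms unfolding maximal_clique_def by blast
  have vz: "v \<in> V" "z \<in> V" "v \<noteq> z" "x \<noteq> z" "x \<noteq> v"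
    using z assms K unfolding maximal_clique_def by (auto simp: insert_commute)
  obtain P where P: "nine_path v z P" using nine_path_exists vz z by blast
  then have P': "length P = 9" "distinct P" "hd P = v" "last P = z" "path_edges P \<subseteq> E"
    unfolding nine_path_def by auto
  have "P \<noteq> []" using P' by auto
  note stays = path_stays_in_clique[OF K]
  \<comment> \<open>If the path missed \<open>x\<close>, then \<open>x\<close> followed by the path would be a path with 10 vertices
    that leaves \<open>K\<close> and comes back.\<close>
  have "x \<in> set P"
  proof (rule ccontr)
    assume "x \<notin> set P"
    then have "set (x # P) \<subseteq> K"
      using P' \<open>P \<noteq> []\<close> z assms by (intro stays) (auto simp: path_edges_Cons)
    then show False using P' \<open>P \<noteq> []\<close> \<open>v \<in> V - K\<close> hd_in_set by fastforce
  qed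
  then obtain p s where ps: "P = p @ x # s" by (meson split_list)
  have "p \<noteq> []" using ps P' vz by auto
  have "s \<noteq> []" using ps P' vz by auto
  have "hd p = v" using ps P' \<open>p \<noteq> []\<close> by auto
  have "set (x # s) \<subseteq> K"
    using P' ps \<open>s \<noteq> []\<close> z \<open>x \<in> K\<close> by (intro stays) (auto simp: path_edges_append)
  moreover have "set p \<inter> K = {}"
  proof (rule ccontr)
    assume "set p \<inter> K \<noteq> {}"
    then obtain w where w: "w \<in> set p" "w \<in> K" by blast
    then obtain q q' where q: "p = q @ w # q'" by (meson split_list)
    have "q \<noteq> []" using q \<open>hd p = v\<close> w \<open>v \<in> V - K\<close> by auto
    then have "hd q = v" using q \<open>hd p = v\<close> by auto
    have "set (x # q @ [w]) \<subseteq> K"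
      using P' ps q \<open>q \<noteq> []\<close> \<open>hd q = v\<close> w \<open>x \<in> K\<close> \<open>{x, v} \<in> E\<close>
      by (intro stays) (auto simp: path_edges_append path_edges_Cons)
    then show False using \<open>q \<noteq> []\<close> \<open>hd q = v\<close> \<open>v \<in> V - K\<close> hd_in_set by auto
  qed
  ultimately have "length s \<le> 1"
    using nine_path_leaves_clique_at_end[OF K \<open>x \<in> K\<close>, of s p v z] P ps vz z \<open>p \<noteq> []\<close> by auto
  then have "length (p @ [x]) = 8" using P' ps \<open>s \<noteq> []\<close> by (cases s) auto
  moreover have "path_edges (p @ [x]) \<subseteq> E" using P' ps by (auto simp: path_edges_append)
  ultimately show False
    using no_cycle_list[of "p @ [x]"] P' ps \<open>p \<noteq> []\<close> \<open>hd p = v\<close> \<open>{x, v} \<in> E\<close> by auto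
qed

end

section \<open>Connectivity\<close>

lemma connected_graph_crossing_edge:
  assumes "connected_graph V E" "K \<subseteq> V" "K \<noteq> {}" "K \<noteq> V" "\<And>u v. {u, v} \<in> E \<Longrightarrow> v \<in> V"
  obtains x v where "x \<in> K" "v \<in> V - K" "{x, v} \<in> E"
proof -
  obtain u w where uw: "u \<in> K" "w \<in> V - K" using assms by blast
  have "(u, w) \<in> {(x, y). {x, y} \<in> E}\<^sup>*"
    using assms uw unfolding connected_graph_def by blast
  then have "w \<in> K \<or> (\<exists>x v. x \<in> K \<and> v \<in> V - K \<and> {x, v} \<in> E)"
    by (induction rule: rtrancl_induct) (use uw assms(5) in auto)
  then show thesis using that uw by blast
qed

lemma k_connected_imp_connected_graph:
  assumes "k_connected k V E" "0 < k"
  shows "connected_graph V E"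
proof -
  have "connected_graph (V - {}) {e \<in> E. e \<inter> {} = {}}"
    using assms unfolding k_connected_def by (metis card.empty empty_subsetI)
  then show ?thesis by simp
qed

theorem proposition5p1:
  shows "\<not> (\<exists>(V :: 'a set) E. simple_graph V E \<and> k_connected 2 V E \<and> nontrivial 9 V \<and>
    uniquely_cycle_saturated 9 V E \<and> longest_even_cycle_length E 12 4)"
proof
  assume "\<exists>(V :: 'a set) E. simple_graph V E \<and> k_connected 2 V E \<and> nontrivial 9 V \<and>
    uniquely_cycle_saturated 9 V E \<and> longest_even_cycle_length E 12 4"
  then obtain V :: "'a set" and E where G: "simple_graph V E" "k_connected 2 V E" "nontrivial 9 V"
    "uniquely_cycle_saturated 9 V E" "longest_even_cycle_length E 12 4" by blast
  then interpret uniquely_C9_saturated_sparse V E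
    by unfold_locales (auto simp: longest_even_cycle_length_12_4)
  obtain K where K: "maximal_clique K" "4 \<le> card K"
    using maximal_clique_exists G(5) longest_even_cycle_length_12_4 by blast
  have "finite V" using simple unfolding simple_graph_def by blast
  have "K \<subseteq> V" "all_pairs K \<subseteq> E" using K unfolding maximal_clique_def by auto
  have "K \<noteq> V"
    using has_cycle_clique[of K E 9] no_C9 \<open>all_pairs K \<subseteq> E\<close> \<open>finite V\<close> G(3)
    unfolding nontrivial_def by auto
  moreover have "connected_graph V E"
    using k_connected_imp_connected_graph[OF G(2)] by simp
  moreover have "K \<noteq> {}" using K by auto
  ultimately obtain x v where "x \<in> K" "v \<in> V - K" "{x, v} \<in> E"
    using connected_graph_crossing_edge[of V E K] \<open>K \<subseteq> V\<close> edge_in_V by blast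
  then show False using maximal_clique_no_outgoing_edge[OF K] by blast
qed

end
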